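(* Let $s\ge 9$ be a multiple of $3$ and let $n=6s+1$. Then the edge set of the complete graph on vertex set $\{0,1,\ldots,n-1\}$ can be partitioned into the edge sets of three circle graphs $C_1,C_2,C_3$ on $n$ vertices such that for each $i=1,2,3$, the largest diameter two subgraph of $C_i$ contains at most $2s+3$ vertices.
   Context: For an integer $n\ge 2$ and a set $S\subseteq\{1,\ldots,\lfloor n/2\rfloor\}$, the circle graph on $n$ vertices determined by $S$ is the graph with vertex set $\{0,1,\ldots,n-1\}$ in which two vertices $x,y$ are adjacent if and only if $(x-y)\bmod n\in S$ or $(y-x)\bmod n\in S$. A diameter two subgraph of a graph $G$ is a subgraph $H$ of $G$ such that for every pair of vertices $x,y$ of $H$ there is a path in $H$ joining $x$ and $y$ with at most two edges; its size is its number of vertices. *)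

theory Defs
  imports Main "HOL-Library.Ramsey" "HOL-Library.Disjoint_Sets"
begin

record 'a ugraph =
  verts :: "'a set"
  edges :: "'a set set"

definition complete_graph :: "'a set \<Rightarrow> 'a ugraph" where
  "complete_graph V = \<lparr>verts = V, edges = nsets V 2\<rparr>"

text \<open>The parameters of interest satisfy \<open>n \<ge> 2\<close> and \<open>S \<subseteq> {1..n div 2}\<close>. Then \<open>0 \<notin> S\<close>, so every
  edge has two elements. Note that \<open>mod\<close> on integers takes values in \<open>{0..<n}\<close>, also for
  negative differences.\<close>

definition circle_graph :: "int \<Rightarrow> int set \<Rightarrow> int ugraph" where
  "circle_graph n S =
    \<lparr>verts = {0..n - 1},
     edges = {{x, y} | x y. x \<in> {0..n - 1} \<and> y \<in> {0..n - 1} \<and>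
       ((x - y) mod n \<in> S \<or> (y - x) mod n \<in> S)}\<rparr>"

definition subgraph :: "'a ugraph \<Rightarrow> 'a ugraph \<Rightarrow> bool" where
  "subgraph H G \<longleftrightarrow> verts H \<subseteq> verts G \<and> edges H \<subseteq> edges G \<and> (\<forall>e\<in>edges H. e \<subseteq> verts H)"

text \<open>A path is given by its list of vertices, so it has \<open>length p - 1\<close> edges.\<close>

definition path_between :: "'a ugraph \<Rightarrow> 'a \<Rightarrow> 'a list \<Rightarrow> 'a \<Rightarrow> bool" where
  "path_between G x p y \<longleftrightarrow>
    p \<noteq> [] \<and> hd p = x \<and> last p = y \<and> distinct p \<and> set p \<subseteq> verts G \<and>
    (\<forall>i. Suc i < length p \<longrightarrow> {p ! i, p ! Suc i} \<in> edges G)"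

definition diameter_two_subgraph :: "'a ugraph \<Rightarrow> 'a ugraph \<Rightarrow> bool" where
  "diameter_two_subgraph H G \<longleftrightarrow> subgraph H G \<and>
    (\<forall>x\<in>verts H. \<forall>y\<in>verts H. \<exists>p. path_between H x p y \<and> length p - 1 \<le> 2)"

end

(*
Write s = 3t, so n = 18t + 1. The three sets of distances are {1..3t}, {5t+1..8t} and
{3t+1..5t} \<union> {8t+1..9t}. Let V be the vertex set of a diameter two subgraph. A distance that is
neither in S nor congruent to a sum of two elements of S or -S does not occur in V, and the three
sets leave out the intervals [6t+1, 9t], [8t+1, 9t] and [2t, 3t] respectively. The first forces V
into an arc of 6t + 1 points. For the second, either V lies in an arc of length 8t, whose middle
quarter has no neighbours in it, or V contains three points with cyclic gaps at most 8t, and then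
the forbidden distances exclude the other vertices of the cycle or match them up in pairs. For the third, either V has a
gap longer than 3t, and what remains splits into three windows of length 5t that contain at most
2t points each, or a greedy walk around the cycle shows that V has density below 1/3.
*)
theory Submission
  imports Defs
begin

subsection \<open>Periodic lifts of subsets of a cycle\<close>

text \<open>The preimage of \<open>V\<close> under reduction modulo \<open>n\<close>: arcs and gaps
  of the cycle become integer intervals without wraparound.\<close>

definition unroll :: "int \<Rightarrow> int set \<Rightarrow> int set" where
  "unroll n V = {z. z mod n \<in> V}"

lemma unroll_add_iff: "z + n \<in> unroll n V \<longleftrightarrow> z \<in> unroll n V"
  by (simp add: unroll_def)

text \<open>Any \<open>n\<close> consecutive integers represent each residue once, so the vertices
  can be counted from whichever starting point is convenient.\<close>

lemma card_unroll_window: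
  assumes "n > 0" and "V \<subseteq> {0..<n}"
  shows "card (unroll n V \<inter> {a<..a + n}) = card V"
proof -
  have "inj_on (\<lambda>z. z mod n) (unroll n V \<inter> {a<..a + n})"
  proof (rule inj_onI)
    fix x y assume x: "x \<in> unroll n V \<inter> {a<..a + n}" and y: "y \<in> unroll n V \<inter> {a<..a + n}"
      and eq: "x mod n = y mod n"
    then have "n dvd x - y" by (simp add: mod_eq_dvd_iff)
    moreover have "\<bar>x - y\<bar> < n" using x y by auto
    ultimately show "x = y"
      by (metis dvd_imp_le_int eq_iff_diff_eq_0 abs_of_pos assms(1) not_le)
  qed
  moreover have "(\<lambda>z. z mod n) ` (unroll n V \<inter> {a<..a + n}) = V"
  proof
    show "V \<subseteq> (\<lambda>z. z mod n) ` (unroll n V \<inter> {a<..a + n})"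
    proof
      fix v assume v: "v \<in> V"
      define z where "z = a + 1 + (v - a - 1) mod n"
      have "z mod n = v mod n" unfolding z_def by (simp add: mod_simps)
      then have zv: "z mod n = v" using v assms(2) by auto
      moreover have "z \<in> {a<..a + n}"
        unfolding z_def using pos_mod_bound[OF assms(1), of "v - a - 1"]
          pos_mod_sign[OF assms(1), of "v - a - 1"] by simp
      ultimately show "v \<in> (\<lambda>z. z mod n) ` (unroll n V \<inter> {a<..a + n})"
        using v by (force simp: unroll_def)
    qed
  qed (auto simp: unroll_def)
  ultimately show ?thesis by (metis card_image)
qed

lemma nonempty_unroll:
  assumes "V \<subseteq> {0..<n}" and "V \<noteq> {}"
  shows "\<exists>x. x \<in> unroll n V"
proof -
  obtain v where "v \<in> V" using assms(2) by blast
  moreover have "v mod n = v" using \<open>v \<in> V\<close> assms(1) by auto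
  ultimately have "v \<in> unroll n V" by (simp add: unroll_def)
  then show ?thesis by blast
qed

lemma card_Un3_le: "card (A \<union> B \<union> C) \<le> card A + card B + card C"
  using card_Un_le[of "A \<union> B" C] card_Un_le[of A B] by linarith

text \<open>Each pair \<open>x\<close>, \<open>x + d\<close> contains at most one point of
  \<open>W\<close>, and the pairs are indexed by the first interval. That interval may be empty,
  when \<open>a = b + 1\<close>.\<close>

lemma card_matched_intervals_le:
  fixes a b d :: int
  assumes "a \<le> b + 1" and avoid: "\<And>x. x \<in> W \<Longrightarrow> x + d \<notin> W"
  shows "int (card (W \<inter> {a..b}) + card (W \<inter> {a + d..b + d})) \<le> b - a + 1"
proof -
  have "W \<inter> {a + d..b + d} \<subseteq> (\<lambda>x. x + d) ` ({a..b} - W)"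
  proof
    fix y assume y: "y \<in> W \<inter> {a + d..b + d}"
    then have "y - d \<in> {a..b} - W" using avoid[of "y - d"] by auto
    then show "y \<in> (\<lambda>x. x + d) ` ({a..b} - W)" by (metis diff_add_cancel image_eqI)
  qed
  then have "card (W \<inter> {a + d..b + d}) \<le> card ({a..b} - W)"
    by (rule surj_card_le[rotated]) auto
  moreover have "card {a..b} = card (W \<inter> {a..b}) + card ({a..b} - W)"
    by (subst card_Un_disjoint[symmetric])
      (auto intro!: arg_cong[where f = card] simp del: card_atLeastAtMost_int)
  ultimately show ?thesis using assms(1) by auto
qed

subsection \<open>Circle graphs and their diameter two subgraphs\<close>

lemma circle_graph_edge_iff:
  assumes "x \<in> {0..n - 1}" and "y \<in> {0..n - 1}"
  shows "{x, y} \<in> edges (circle_graph n S) \<longleftrightarrow> (x - y) mod n \<in> S \<or> (y - x) mod n \<in> S"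
  using assms by (auto simp: circle_graph_def doubleton_eq_iff)

lemma circle_graph_edgeE:
  assumes "e \<in> edges (circle_graph n S)" and "S \<subseteq> {1..n div 2}"
  obtains x y where "0 \<le> x" and "x < y" and "y < n" and "e = {x, y}"
    and "y - x \<in> S \<or> n - (y - x) \<in> S"
proof -
  note result = that
  have main: thesis if xy: "x \<in> {0..n - 1}" "y \<in> {0..n - 1}" "x \<le> y" "e = {x, y}"
    "(x - y) mod n \<in> S \<or> (y - x) mod n \<in> S" for x y
  proof -
    have "x \<noteq> y" using xy assms(2) by auto
    then have lt: "x < y" using xy by simp
    have "(y - x) mod n = y - x" using xy lt by (intro mod_pos_pos_trivial) auto
    moreover have "(x - y) mod n = n - (y - x)"
    proof -
      have "(x - y) mod n = (n - (y - x)) mod n" by (simp add: mod_diff_eq)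
      also have "\<dots> = n - (y - x)" using xy lt by (intro mod_pos_pos_trivial) auto
      finally show ?thesis .
    qed
    ultimately show thesis using result[of x y] xy lt by auto
  qed
  obtain x y where xy: "x \<in> {0..n - 1}" "y \<in> {0..n - 1}" "e = {x, y}"
    "(x - y) mod n \<in> S \<or> (y - x) mod n \<in> S"
    using assms(1) by (auto simp: circle_graph_def)
  show thesis
  proof (cases "x \<le> y")
    case True then show thesis using main[of x y] xy by blast
  next
    case False then show thesis using main[of y x] xy by (auto simp: insert_commute)
  qed
qed

text \<open>An edge has the two differences \<open>d\<close> and \<open>n - d\<close>. At least one
  is at most \<open>n div 2\<close>, and both are only if they coincide, so each edge belongs to
  exactly one class. Nonempty classes yield nonempty, hence distinct, blocks.\<close>

lemma circle_graphs_partition: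
  fixes S :: "'i \<Rightarrow> int set"
  assumes ne: "\<And>i. i \<in> I \<Longrightarrow> S i \<noteq> {}"
    and un: "(\<Union>i\<in>I. S i) = {1..n div 2}"
    and disj: "disjoint_family_on S I"
  shows "inj_on (\<lambda>i. edges (circle_graph n (S i))) I"
    and "partition_on (edges (complete_graph {0..n - 1}))
      ((\<lambda>i. edges (circle_graph n (S i))) ` I)"
proof -
  let ?E = "\<lambda>i. edges (circle_graph n (S i))"
  have sub: "S i \<subseteq> {1..n div 2}" if "i \<in> I" for i using un that by blast
  have nonempty: "?E i \<noteq> {}" if i: "i \<in> I" for i
  proof -
    obtain d where d: "d \<in> S i" using ne[OF i] by blast
    then have "1 \<le> d" "d \<le> n div 2" using sub[OF i] by auto
    then have "d mod n = d" "d < n" by auto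
    then have "{0, d} \<in> ?E i"
      using d \<open>1 \<le> d\<close> by (subst circle_graph_edge_iff) auto
    then show ?thesis by blast
  qed
  have same: "i = j" if i: "i \<in> I" and j: "j \<in> I" and e: "e \<in> ?E i" "e \<in> ?E j" for i j e
  proof -
    obtain x y where xy: "x < y" "y < n" "e = {x, y}" "y - x \<in> S i \<or> n - (y - x) \<in> S i"
      using circle_graph_edgeE[OF e(1) sub[OF i]] by metis
    obtain x' y' where xy': "x' < y'" "e = {x', y'}" "y' - x' \<in> S j \<or> n - (y' - x') \<in> S j"
      using circle_graph_edgeE[OF e(2) sub[OF j]] by metis
    have [simp]: "x' = x" "y' = y" using xy xy' by (auto simp: doubleton_eq_iff)
    have le: "d \<le> n div 2" if "d \<in> S i \<union> S j" for d using that sub[OF i] sub[OF j] by auto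
    have "S i \<inter> S j \<noteq> {}"
    proof (rule ccontr)
      assume "\<not> ?thesis"
      \<comment> \<open>With disjoint classes the two differences would be distinct and both at most
        \<open>n div 2\<close>, although their sum is \<open>n\<close>.\<close>
      then have "y - x \<in> S i \<union> S j" "n - (y - x) \<in> S i \<union> S j" and "y - x \<noteq> n - (y - x)"
        using xy(4) xy'(3) by (force, force, force)
      then show False using le[of "y - x"] le[of "n - (y - x)"] by presburger
    qed
    then show ?thesis using disj i j by (auto simp: disjoint_family_on_def)
  qed
  show inj: "inj_on ?E I"
  proof (rule inj_onI)
    fix i j assume "i \<in> I" "j \<in> I" "?E i = ?E j"
    then show "i = j" using nonempty[of i] same[of i j] by blast
  qed
  show "partition_on (edges (complete_graph {0..n - 1})) (?E ` I)"
  proof (rule partition_onI)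
    show "\<Union> (?E ` I) = edges (complete_graph {0..n - 1})"
    proof
      show "\<Union> (?E ` I) \<subseteq> edges (complete_graph {0..n - 1})"
      proof
        fix e assume "e \<in> \<Union> (?E ` I)"
        then obtain i where i: "i \<in> I" "e \<in> ?E i" by blast
        obtain x y where "0 \<le> x" "x < y" "y < n" "e = {x, y}"
          using circle_graph_edgeE[OF i(2) sub[OF i(1)]] by metis
        then show "e \<in> edges (complete_graph {0..n - 1})"
          by (auto simp: complete_graph_def nsets_def card_insert_if)
      qed
      show "edges (complete_graph {0..n - 1}) \<subseteq> \<Union> (?E ` I)"
      proof
        fix e assume "e \<in> edges (complete_graph {0..n - 1})"
        then obtain x y where xy: "x \<in> {0..n - 1}" "y \<in> {0..n - 1}" "x < y" "e = {x, y}"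
          by (auto simp: complete_graph_def nsets_def card_2_iff)
            (metis insert_commute linorder_less_linear)
        have 1: "(y - x) mod n = y - x" using xy by (intro mod_pos_pos_trivial) auto
        have "(x - y) mod n = (n - (y - x)) mod n" by simp
        also have "\<dots> = n - (y - x)" using xy by (intro mod_pos_pos_trivial) auto
        finally have 2: "(x - y) mod n = n - (y - x)" .
        have "y - x \<in> {1..n div 2} \<or> n - (y - x) \<in> {1..n div 2}" using xy by auto
        then obtain i where "i \<in> I" "y - x \<in> S i \<or> n - (y - x) \<in> S i" using un by blast
        then show "e \<in> \<Union> (?E ` I)"
          using circle_graph_edge_iff[OF xy(1,2), of "S i"] 1 2 xy(4) by auto
      qed
    qed
    show "{} \<notin> ?E ` I" using nonempty by auto
    show "disjnt p q" if "p \<in> ?E ` I" "q \<in> ?E ` I" "p \<noteq> q" for p q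
      using that same unfolding disjnt_iff by blast
  qed
qed

lemma diameter_two_adjacent_or_midpoint:
  assumes "diameter_two_subgraph H G" and x: "x \<in> verts H" and y: "y \<in> verts H" and "x \<noteq> y"
  shows "{x, y} \<in> edges G \<or> (\<exists>m\<in>verts H. {x, m} \<in> edges G \<and> {m, y} \<in> edges G)"
proof -
  have sub: "edges H \<subseteq> edges G"
    using assms(1) by (auto simp: diameter_two_subgraph_def subgraph_def)
  obtain p where "path_between H x p y" and len: "length p \<le> 3"
    using assms(1) x y by (force simp: diameter_two_subgraph_def)
  then have p: "p \<noteq> []" "hd p = x" "last p = y" "set p \<subseteq> verts H"
    and e: "\<And>i. Suc i < length p \<Longrightarrow> {p ! i, p ! Suc i} \<in> edges H"
    by (auto simp: path_between_def)
  consider a where "p = [a]" | a b where "p = [a, b]" | a b c where "p = [a, b, c]"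
    using p(1) len by (cases p; cases "tl p"; cases "tl (tl p)") auto
  then show ?thesis
  proof cases
    case 1 then show ?thesis using p \<open>x \<noteq> y\<close> by simp
  next
    case 2 then show ?thesis using p e[of 0] sub by auto
  next
    case 3 then show ?thesis using p e[of 0] e[of 1] sub by auto
  qed
qed

text \<open>The connection set \<open>S\<close> together with \<open>-S\<close> of a circulant
  graph, with \<open>-d\<close> represented by the residue \<open>n - d\<close>.\<close>

definition sym_dists :: "int \<Rightarrow> int set \<Rightarrow> int set" where
  "sym_dists n S = S \<union> (\<lambda>d. n - d) ` S"

lemma sym_dists_interval: "sym_dists n {a..b} = {a..b} \<union> {n - b..n - a}"
  by (simp add: sym_dists_def)

lemma sym_dists_Un: "sym_dists n (A \<union> B) = sym_dists n A \<union> sym_dists n B"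
  by (auto simp: sym_dists_def)

lemma circle_graph_edge_sym_dists:
  assumes "S \<subseteq> {1..n div 2}" and "x \<in> {0..n - 1}" and "y \<in> {0..n - 1}"
    and "{x, y} \<in> edges (circle_graph n S)"
  shows "(y - x) mod n \<in> sym_dists n S"
proof -
  consider "(y - x) mod n \<in> S" | "(x - y) mod n \<in> S"
    using assms circle_graph_edge_iff by metis
  then show ?thesis
  proof cases
    case 2
    then have "(x - y) mod n \<noteq> 0" using assms(1) by auto
    then have "(y - x) mod n = n - (x - y) mod n"
      using zmod_zminus1_eq_if[of "x - y" n] by auto
    then show ?thesis using 2 by (auto simp: sym_dists_def)
  qed (simp add: sym_dists_def)
qed

section \<open>Forbidden differences in a diameter two subgraph\<close>

context
  fixes n :: int and S :: "int set" and H :: "int ugraph"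
  assumes S: "S \<subseteq> {1..n div 2}" and n: "n > 0"
    and H: "diameter_two_subgraph H (circle_graph n S)"
begin

lemma verts_in_range: "verts H \<subseteq> {0..<n}"
  using H by (auto simp: diameter_two_subgraph_def subgraph_def circle_graph_def)

lemma unroll_adjacent_or_midpoint:
  assumes x: "x \<in> unroll n (verts H)" and y: "y \<in> unroll n (verts H)" and ne: "x mod n \<noteq> y mod n"
  shows "(y - x) mod n \<in> sym_dists n S \<or>
    (\<exists>m\<in>unroll n (verts H). (m - x) mod n \<in> sym_dists n S \<and> (y - m) mod n \<in> sym_dists n S)"
proof -
  let ?N = "sym_dists n S"
  have adj: "(b - a) mod n \<in> ?N"
    if "a mod n \<in> verts H" "b mod n \<in> verts H" "{a mod n, b mod n} \<in> edges (circle_graph n S)" for a b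
    using circle_graph_edge_sym_dists[OF S _ _ that(3)] n by (simp add: mod_simps)
  have V: "x mod n \<in> verts H" "y mod n \<in> verts H" using x y by (auto simp: unroll_def)
  have "{x mod n, y mod n} \<in> edges (circle_graph n S) \<or>
    (\<exists>m\<in>verts H. {x mod n, m} \<in> edges (circle_graph n S) \<and> {m, y mod n} \<in> edges (circle_graph n S))"
    by (rule diameter_two_adjacent_or_midpoint[OF H V ne])
  then show ?thesis
  proof (elim disjE bexE conjE)
    fix m assume m: "m \<in> verts H" "{x mod n, m} \<in> edges (circle_graph n S)"
      "{m, y mod n} \<in> edges (circle_graph n S)"
    then have "m mod n = m" using verts_in_range by auto
    then show ?thesis using adj[of x m] adj[of m y] m V by (auto simp: unroll_def)
  qed (use adj V in auto)
qed

lemma unroll_neighbour: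
  assumes "x \<in> unroll n (verts H)" and "y \<in> unroll n (verts H)" and "x mod n \<noteq> y mod n"
  shows "\<exists>m\<in>unroll n (verts H). (m - x) mod n \<in> sym_dists n S"
  using unroll_adjacent_or_midpoint[OF assms] assms(2) by blast

text \<open>The residues of \<open>m - x\<close> and \<open>x + d - m\<close> lie below
  \<open>n\<close> and their sum is congruent to \<open>d\<close>, so it is \<open>d\<close> or
  \<open>n + d\<close>. The hypotheses exclude both values as well as a direct edge.\<close>

lemma unroll_avoids:
  assumes x: "x \<in> unroll n (verts H)" and d: "0 < d" "d < n" "d \<notin> sym_dists n S"
    and sums: "\<And>a b. a \<in> sym_dists n S \<Longrightarrow> b \<in> sym_dists n S \<Longrightarrow> a + b \<noteq> d \<and> a + b \<noteq> n + d"
  shows "x + d \<notin> unroll n (verts H)"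
proof
  assume y: "x + d \<in> unroll n (verts H)"
  have dmod: "d mod n = d" using d by simp
  have "x mod n \<noteq> (x + d) mod n"
    using d by (metis dmod mod_eq_dvd_iff add_diff_cancel_left' dvd_eq_mod_eq_0 less_irrefl)
  then consider "(x + d - x) mod n \<in> sym_dists n S"
    | m where "(m - x) mod n \<in> sym_dists n S" "(x + d - m) mod n \<in> sym_dists n S"
    using unroll_adjacent_or_midpoint[OF x y] by blast
  then show False
  proof cases
    case 1 then show False using d dmod by simp
  next
    case 2
    let ?a = "(m - x) mod n" and ?b = "(x + d - m) mod n"
    have two: "u = d \<or> u = n + d" if "u mod n = d" "0 \<le> u" "u < 2 * n" for u
      using that mod_pos_pos_trivial[of u n] mod_pos_pos_trivial[of "u - n" n]
      by (cases "u < n") auto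
    have "(?a + ?b) mod n = d" using dmod by (simp add: mod_simps)
    moreover have "0 \<le> ?a" "?a < n" "0 \<le> ?b" "?b < n" using n by auto
    ultimately have "?a + ?b = d \<or> ?a + ?b = n + d" by (intro two) linarith+
    then show False using sums 2 by blast
  qed
qed

end


subsection \<open>The three classes of distances\<close>

text \<open>Let \<open>y\<close> be the last vertex at most 6t after \<open>x\<close>. Any later
  vertex is at least 12t + 1 after \<open>x\<close>, hence more than 6t after \<open>y\<close>; by
  the forbidden differences it is then at most 6t before \<open>y + n\<close>.\<close>

lemma card_central_class_le:
  fixes t :: int
  assumes t: "t \<ge> 1" and n: "n = 18 * t + 1" and H: "diameter_two_subgraph H (circle_graph n {1..3 * t})"
  shows "int (card (verts H)) \<le> 6 * t + 1"
proof (cases "verts H = {}")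
  case False
  let ?S = "{1..3 * t}" and ?W = "unroll n (verts H)"
  have S: "?S \<subseteq> {1..n div 2}" and n0: "n > 0" using t n by auto
  note V = verts_in_range[OF S n0 H] and card = card_unroll_window[OF n0 verts_in_range[OF S n0 H]]
  have low: "x + d \<notin> ?W" if "x \<in> ?W" "6 * t + 1 \<le> d" "d \<le> 9 * t" for x d
  proof (rule unroll_avoids[OF S n0 H that(1)])
    show "0 < d" "d < n" "d \<notin> sym_dists n ?S"
      using t n that(2,3) by (auto simp: sym_dists_interval)
    show "a + b \<noteq> d \<and> a + b \<noteq> n + d" if "a \<in> sym_dists n ?S" "b \<in> sym_dists n ?S" for a b
      using that t n \<open>6 * t + 1 \<le> d\<close> \<open>d \<le> 9 * t\<close> unfolding sym_dists_interval by (elim UnE) auto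
  qed
  have avoid: "x + d \<notin> ?W" if "x \<in> ?W" "6 * t + 1 \<le> d" "d \<le> 12 * t" for x d
  proof (cases "d \<le> 9 * t")
    \<comment> \<open>A step by \<open>d\<close> > 9t is a step by \<open>n - d\<close> in the
      opposite direction, and \<open>n - d\<close> lies in the range already treated.\<close>
    case False
    then have "x + d \<in> ?W \<Longrightarrow> x + d + (n - d) \<notin> ?W" using that n by (intro low) auto
    then show ?thesis using that(1) unroll_add_iff[of x n] by auto
  qed (use that low in blast)
  obtain x where x: "x \<in> ?W" using False nonempty_unroll[OF V] by blast
  define y where "y = Max (?W \<inter> {x..x + 6 * t})"
  have "y \<in> ?W \<inter> {x..x + 6 * t}" unfolding y_def using x t by (intro Max_in) auto
  then have y: "y \<in> ?W" "x \<le> y" "y \<le> x + 6 * t" by auto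
  have ymax: "z \<le> y" if "z \<in> ?W" "x \<le> z" "z \<le> x + 6 * t" for z
    unfolding y_def using that by (intro Max_ge) auto
  have "?W \<inter> {y<..y + n} \<subseteq> {y + n - 6 * t..y + n}"
  proof
    fix z assume z: "z \<in> ?W \<inter> {y<..y + n}"
    have "z \<ge> x + 12 * t + 1"
      using ymax[of z] avoid[OF x, of "z - x"] z y by force
    moreover have "\<not> (6 * t + 1 \<le> z - y \<and> z - y \<le> 12 * t)" using avoid[OF y(1), of "z - y"] z by force
    ultimately show "z \<in> {y + n - 6 * t..y + n}" using z y n t by auto
  qed
  then have "card (?W \<inter> {y<..y + n}) \<le> card {y + n - 6 * t..y + n}" by (intro card_mono) auto
  then show ?thesis using card t by simp
qed (use t in auto)

text \<open>Edges have residues in [5t+1, 8t] and [10t+1, 13t], with sums in [10t+2, 26t]. These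
  miss both \<open>d\<close> and \<open>n + d\<close> \<ge> 26t + 2 for \<open>d\<close> in
  [8t+1, 9t].\<close>

lemma card_outer_class_le:
  fixes t :: int
  assumes t: "t \<ge> 1" and n: "n = 18 * t + 1"
    and H: "diameter_two_subgraph H (circle_graph n {5 * t + 1..8 * t})"
  shows "int (card (verts H)) \<le> 6 * t + 2"
proof (cases "card (verts H) \<le> 1")
  case False
  let ?S = "{5 * t + 1..8 * t}" and ?W = "unroll n (verts H)"
  have S: "?S \<subseteq> {1..n div 2}" and n0: "n > 0" using t n by auto
  note V = verts_in_range[OF S n0 H] and card = card_unroll_window[OF n0 verts_in_range[OF S n0 H]]
  have low: "x + d \<notin> ?W" if "x \<in> ?W" "8 * t + 1 \<le> d" "d \<le> 9 * t" for x d
  proof (rule unroll_avoids[OF S n0 H that(1)])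
    show "0 < d" "d < n" "d \<notin> sym_dists n ?S"
      using t n that(2,3) by (auto simp: sym_dists_interval)
    show "a + b \<noteq> d \<and> a + b \<noteq> n + d" if "a \<in> sym_dists n ?S" "b \<in> sym_dists n ?S" for a b
      using that t n \<open>8 * t + 1 \<le> d\<close> \<open>d \<le> 9 * t\<close> unfolding sym_dists_interval by (elim UnE) auto
  qed
  have avoid: "x + d \<notin> ?W" if "x \<in> ?W" "8 * t + 1 \<le> d" "d \<le> 10 * t" for x d
  proof (cases "d \<le> 9 * t")
    case False
    then have "x + d \<in> ?W \<Longrightarrow> x + d + (n - d) \<notin> ?W" using that n by (intro low) auto
    then show ?thesis using that(1) unroll_add_iff[of x n] by auto
  qed (use that low in blast)
  have "verts H \<noteq> {}" using False by auto
  then obtain x where x: "x \<in> ?W" using nonempty_unroll[OF V] by blast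
  define y where "y = Max (?W \<inter> {x..x + 8 * t})"
  have "y \<in> ?W \<inter> {x..x + 8 * t}" unfolding y_def using x t by (intro Max_in) auto
  then have y: "y \<in> ?W" "x \<le> y" "y \<le> x + 8 * t" by auto
  have ymax: "z \<le> y" if "z \<in> ?W" "x \<le> z" "z \<le> x + 8 * t" for z
    unfolding y_def using that by (intro Max_ge) auto
  have after_y: "z \<ge> x + 10 * t + 1" if "z \<in> ?W" "y < z" for z
    using ymax[of z] avoid[OF x, of "z - x"] that y by force
  show ?thesis
  proof (cases "\<exists>z\<in>?W. y < z \<and> z \<le> y + 8 * t \<and> z < x + n")
    case False
    define a where "a = y + 10 * t + 1"
    have arc: "?W \<inter> {y<..y + n} \<subseteq> {a..a + 8 * t}"
    proof
      fix z assume z: "z \<in> ?W \<inter> {y<..y + n}"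
      have "z \<ge> a"
      \<comment> \<open>If \<open>z\<close> is at least \<open>x + n\<close>, then \<open>y\<close>
        \<le> x + 8t already gives \<open>z\<close> \<ge> y + 10t + 1.\<close>
      proof (cases "z < x + n")
        case True
        then have "z > y + 8 * t" using False z by force
        then show ?thesis using avoid[OF y(1), of "z - y"] z unfolding a_def by force
      qed (use y n in \<open>simp add: a_def\<close>)
      then show "z \<in> {a..a + 8 * t}" using z n unfolding a_def by simp
    qed
    \<comment> \<open>All points of the arc are within 5t of such a \<open>z\<close>, while edges
      need cyclic distance at least 5t + 1. So \<open>z\<close> would be isolated, which is
      impossible with a second vertex present.\<close>
    have mid: "z \<notin> {a + 3 * t..a + 5 * t}" if z: "z \<in> ?W \<inter> {y<..y + n}" for z
    proof
      assume zm: "z \<in> {a + 3 * t..a + 5 * t}"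
      obtain v where v: "v \<in> verts H" "v \<noteq> z mod n"
        using \<open>\<not> card (verts H) \<le> 1\<close> by (metis card_le_Suc0_iff_eq One_nat_def card.infinite zero_le)
      have "v mod n = v" using v V by auto
      then obtain m where m: "m \<in> ?W" "(m - z) mod n \<in> sym_dists n ?S"
        using unroll_neighbour[OF S n0 H, of z v] z v by (auto simp: unroll_def)
      \<comment> \<open>The lift of the neighbour \<open>m\<close> into the window that the arc
        covers.\<close>
      define w where "w = y + 1 + (m - y - 1) mod n"
      have wm: "w mod n = m mod n" unfolding w_def by (simp add: mod_simps)
      then have "w \<in> ?W" using m(1) by (simp add: unroll_def)
      moreover have "w \<in> {y<..y + n}" unfolding w_def
        using pos_mod_bound[OF n0, of "m - y - 1"] pos_mod_sign[OF n0, of "m - y - 1"] by simp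
      ultimately have w: "w \<in> {a..a + 8 * t}" using arc by blast
      have "(w - z) mod n = (m - z) mod n" using wm by (metis mod_diff_left_eq)
      moreover have "(w - z) mod n = (if w < z then w - z + n else w - z)"
        using w zm t n mod_pos_pos_trivial[of "w - z" n] mod_pos_pos_trivial[of "w - z + n" n] by auto
      ultimately show False
        using m(2) w zm n t by (auto simp: sym_dists_interval split: if_splits)
    qed
    have "?W \<inter> {y<..y + n} \<subseteq> {a..a + 3 * t - 1} \<union> {a + 5 * t + 1..a + 8 * t}"
      using arc mid by force
    then have "card (?W \<inter> {y<..y + n}) \<le> card ({a..a + 3 * t - 1} \<union> {a + 5 * t + 1..a + 8 * t})"
      by (intro card_mono) auto
    also have "\<dots> \<le> card {a..a + 3 * t - 1} + card {a + 5 * t + 1..a + 8 * t}" by (rule card_Un_le)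
    finally show ?thesis using card t by simp
  next
    case True
    then obtain z where z: "z \<in> ?W" "y < z" "z \<le> y + 8 * t" "z < x + n" by blast
    \<comment> \<open>Hence \<open>x + n - z\<close> is at most 8t, like the other two gaps
      \<open>y - x\<close> and \<open>z - y\<close>.\<close>
    have zx: "z \<ge> x + 10 * t + 1" using after_y z by blast
    let ?P = "{x + 1..z - 10 * t - 1}" and ?P' = "{x + 1 + 10 * t..z - 10 * t - 1 + 10 * t}"
    let ?Q = "{z - 8 * t..y - 1}" and ?Q' = "{z - 8 * t + (8 * t + 1)..y - 1 + (8 * t + 1)}"
    let ?R = "{y + 1..x + 8 * t}" and ?R' = "{y + 1 + 10 * t..x + 8 * t + 10 * t}"
    \<comment> \<open>The distances \<open>8 t + 1, ..., 10 t\<close> from \<open>x\<close>, \<open>y\<close>, \<open>z\<close> exclude three disjoint intervals;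
      what is left of the circle, apart from \<open>x\<close>, \<open>y\<close>, \<open>z\<close>, is matched by two of those distances.\<close>
    have "?W \<inter> {x - 1<..x - 1 + n} \<subseteq> {x, y, z} \<union> ((?W \<inter> ?P \<union> ?W \<inter> ?P')
      \<union> (?W \<inter> ?Q \<union> ?W \<inter> ?Q') \<union> (?W \<inter> ?R \<union> ?W \<inter> ?R'))" (is "_ \<subseteq> ?U")
    proof
      fix w assume w: "w \<in> ?W \<inter> {x - 1<..x - 1 + n}"
      then have W: "w \<in> ?W" by simp
      consider "w = x \<or> w = y \<or> w = z" | "x < w" "w < y" | "y < w" "w < z" | "z < w"
        using w by force
      then show "w \<in> ?U"
      proof cases
        case 2
        then have "\<not> (8 * t + 1 \<le> z - w \<and> z - w \<le> 10 * t)" using avoid[OF W, of "z - w"] z by force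
        then have "w \<in> ?P \<or> w \<in> ?Q" using 2 unfolding atLeastAtMost_iff by linarith
        then show ?thesis using W by blast
      next
        case 3
        then have "\<not> (8 * t + 1 \<le> w - x \<and> w - x \<le> 10 * t)" using avoid[OF x, of "w - x"] W by force
        then have "w \<in> ?R \<or> w \<in> ?P'" using 3 unfolding atLeastAtMost_iff by linarith
        then show ?thesis using W by blast
      next
        case 4
        then have "\<not> (8 * t + 1 \<le> w - y \<and> w - y \<le> 10 * t)" using avoid[OF y(1), of "w - y"] W by force
        moreover have "w \<le> x + 18 * t" using w n by simp
        ultimately have "w \<in> ?Q' \<or> w \<in> ?R'" using 4 unfolding atLeastAtMost_iff by linarith
        then show ?thesis using W by blast
      qed auto
    qed
    then have "card (verts H) \<le> card ?U" unfolding card[of "x - 1", symmetric] by (intro card_mono) auto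
    also have "\<dots> \<le> card {x, y, z} + card ((?W \<inter> ?P \<union> ?W \<inter> ?P')
      \<union> (?W \<inter> ?Q \<union> ?W \<inter> ?Q') \<union> (?W \<inter> ?R \<union> ?W \<inter> ?R'))"
      by (rule card_Un_le)
    also have "\<dots> \<le> card {x, y, z} + ((card (?W \<inter> ?P) + card (?W \<inter> ?P'))
      + (card (?W \<inter> ?Q) + card (?W \<inter> ?Q')) + (card (?W \<inter> ?R) + card (?W \<inter> ?R')))"
      by (intro add_left_mono order_trans[OF card_Un3_le] add_mono card_Un_le)
    also have "card {x, y, z} \<le> 3" by (simp add: card_insert_if)
    finally have "int (card (verts H)) \<le> 3 + int (card (?W \<inter> ?P) + card (?W \<inter> ?P'))
      + int (card (?W \<inter> ?Q) + card (?W \<inter> ?Q')) + int (card (?W \<inter> ?R) + card (?W \<inter> ?R'))"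
      by simp
    \<comment> \<open>The lengths of \<open>?P\<close>, \<open>?Q\<close>, \<open>?R\<close> are z -
      x - 10t - 1, y - z + 8t and x + 8t - y. They telescope to 6t - 1, which with the three points
      gives 6t + 2.\<close>
    moreover have "int (card (?W \<inter> ?P) + card (?W \<inter> ?P')) \<le> z - 10 * t - 1 - (x + 1) + 1"
      using zx t by (intro card_matched_intervals_le avoid) auto
    moreover have "int (card (?W \<inter> ?Q) + card (?W \<inter> ?Q')) \<le> y - 1 - (z - 8 * t) + 1"
      using z t by (intro card_matched_intervals_le avoid) auto
    moreover have "int (card (?W \<inter> ?R) + card (?W \<inter> ?R')) \<le> x + 8 * t - (y + 1) + 1"
      using y t by (intro card_matched_intervals_le avoid) auto
    ultimately show ?thesis by linarith
  qed
qed (use t in auto)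



text \<open>The five points \<open>r, r + t, ..., r + 4 t\<close> form a 5-cycle under the forbidden differences
  \<open>2 t\<close> and \<open>3 t\<close>.\<close>

lemma card_window_avoiding_le:
  fixes t p :: int
  assumes t: "t \<ge> 1" and avoid: "\<And>x d. x \<in> W \<Longrightarrow> 2 * t \<le> d \<Longrightarrow> d \<le> 3 * t \<Longrightarrow> x + d \<notin> W"
  shows "int (card (W \<inter> {p..<p + 5 * t})) \<le> 2 * t"
proof -
  let ?C = "\<lambda>r. W \<inter> {r, r + t, r + 2 * t, r + 3 * t, r + 4 * t}"
  have "W \<inter> {p..<p + 5 * t} \<subseteq> (\<Union>r\<in>{p..<p + t}. ?C r)"
  proof
    fix z assume z: "z \<in> W \<inter> {p..<p + 5 * t}"
    \<comment> \<open>The window splits into \<open>t\<close> residue classes modulo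
      \<open>t\<close>, each with five points.\<close>
    define i r where "i = (z - p) div t" and "r = p + (z - p) mod t"
    have zi: "z = r + i * t" unfolding i_def r_def by (simp add: algebra_simps)
    have rr: "r \<in> {p..<p + t}" using t unfolding r_def by simp
    have "i \<ge> 0" using z t unfolding i_def by (simp add: pos_imp_zdiv_nonneg_iff)
    moreover have "i < 5"
    proof (rule ccontr)
      assume "\<not> i < 5"
      then have "5 * t \<le> i * t" using t by (intro mult_right_mono) auto
      then show False using zi z rr by auto
    qed
    ultimately have "i = 0 \<or> i = 1 \<or> i = 2 \<or> i = 3 \<or> i = 4" by auto
    then have "z \<in> ?C r" using z zi by auto
    then show "z \<in> (\<Union>r\<in>{p..<p + t}. ?C r)" using rr by blast
  qed
  then have "card (W \<inter> {p..<p + 5 * t}) \<le> card (\<Union>r\<in>{p..<p + t}. ?C r)" by (intro card_mono) auto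
  also have "\<dots> \<le> (\<Sum>r\<in>{p..<p + t}. card (?C r))" by (rule card_UN_le) simp
  also have "\<dots> \<le> (\<Sum>r\<in>{p..<p + t}. 2)"
  proof (rule sum_mono)
    fix r
    have "r \<in> W \<Longrightarrow> r + 2 * t \<notin> W" "r \<in> W \<Longrightarrow> r + 3 * t \<notin> W"
      "r + t \<in> W \<Longrightarrow> r + 3 * t \<notin> W" "r + t \<in> W \<Longrightarrow> r + 4 * t \<notin> W"
      "r + 2 * t \<in> W \<Longrightarrow> r + 4 * t \<notin> W"
      using avoid[of r "2 * t"] avoid[of r "3 * t"] avoid[of "r + t" "2 * t"]
        avoid[of "r + t" "3 * t"] avoid[of "r + 2 * t" "2 * t"] t
      by (auto simp: algebra_simps)
    \<comment> \<open>An independent set of a 5-cycle has at most two points.\<close>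
    then show "card (?C r) \<le> 2" by (auto simp: Int_insert_right card_insert_if)
  qed
  finally show ?thesis using t by simp
qed

text \<open>If no gap of \<open>W\<close> exceeds \<open>2 t\<close>, consider the greedy jumps from \<open>v\<close> to the last point
  of \<open>W\<close> before \<open>v + 2 t\<close>. Two consecutive jumps exceed \<open>3 t\<close>, because the differences
  \<open>2 t, ..., 3 t\<close> are forbidden. Conversely the endpoint \<open>w\<close> of the next jump confines the
  part of \<open>W\<close> in the jump from \<open>v\<close> to \<open>u\<close> to the interval from \<open>w - 2 t\<close> to \<open>u\<close>.
  Hence two jumps cover at least \<open>3 t + 1\<close> integers, but at most \<open>t - 1\<close> points of \<open>W\<close>.\<close>

lemma card_full_turn_no_gap_le:
  fixes t a :: int
  assumes t: "t \<ge> 1" and avoid: "\<And>x d. x \<in> W \<Longrightarrow> 2 * t \<le> d \<Longrightarrow> d \<le> 3 * t \<Longrightarrow> x + d \<notin> W"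
    and no_gap: "\<And>v. v \<in> W \<Longrightarrow> \<exists>u\<in>W. v < u \<and> u < v + 2 * t" and "W \<noteq> {}"
  shows "\<exists>v. int (card (W \<inter> {v<..v + 18 * t + 1})) \<le> 6 * t"
proof -
  define F where "F v = Max (W \<inter> {v<..<v + 2 * t})" for v
  have "F v \<in> W \<inter> {v<..<v + 2 * t}" if "v \<in> W" for v
    unfolding F_def using no_gap[OF that] by (intro Max_in) auto
  then have F: "F v \<in> W" "v < F v" "F v < v + 2 * t" if "v \<in> W" for v using that by auto
  have F_max: "z \<le> F v" if "z \<in> W" "v < z" "z < v + 2 * t" for v z
    unfolding F_def using that by (intro Max_ge) auto
  have beyond: "z \<ge> v + 3 * t + 1" if "v \<in> W" "z \<in> W" "F v < z" for v z
    using F_max[of z v] F(2)[of v] avoid[of v "z - v"] that by force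
  have jump: "int (card (W \<inter> {F q<..F (F q)})) \<le> F (F q) - F (F (F q)) + 2 * t" if q: "q \<in> W" for q
  proof -
    let ?v = "F q" let ?u = "F ?v" let ?w = "F ?u"
    have mem: "?v \<in> W" "?u \<in> W" "?w \<in> W" using F(1) q by blast+
    have "W \<inter> {?v<..?u} \<subseteq> {?w - 2 * t + 1..?u}"
    proof
      fix z assume z: "z \<in> W \<inter> {?v<..?u}"
      \<comment> \<open>Starting one jump earlier, at \<open>q\<close>, puts \<open>z\<close> beyond
        q + 3t, while the three jumps from \<open>q\<close> to \<open>?w\<close> cover less than
        6t.\<close>
      have "z \<ge> q + 3 * t + 1" using beyond[OF q] z by auto
      moreover have "?w < q + 6 * t" using F(3)[OF q] F(3)[OF mem(1)] F(3)[OF mem(2)] by linarith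
      ultimately have "?w - z < 3 * t" by linarith
      then have "?w - z < 2 * t" using avoid[of z "?w - z"] z mem(3) by force
      then show "z \<in> {?w - 2 * t + 1..?u}" using z by auto
    qed
    then have "card (W \<inter> {?v<..?u}) \<le> card {?w - 2 * t + 1..?u}" by (intro card_mono) auto
    then show ?thesis using F(3)[OF mem(2)] by simp
  qed
  let ?G = "\<lambda>v. F (F v)"
  have double_jump: "int (card (W \<inter> {F q<..?G (F q)})) \<le> t - 1" if q: "q \<in> W" for q
  proof -
    have mem: "F q \<in> W" "?G q \<in> W" "F (?G q) \<in> W" using F(1) q by blast+
    have "{F q<..?G (F q)} = {F q<..?G q} \<union> {?G q<..F (?G q)}"
      using F(2)[OF mem(1)] F(2)[OF mem(2)] by auto
    then have "card (W \<inter> {F q<..?G (F q)}) \<le> card (W \<inter> {F q<..?G q}) + card (W \<inter> {?G q<..F (?G q)})"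
      by (simp add: Int_Un_distrib card_Un_le)
    \<comment> \<open>The two bounds from \<open>jump\<close> telescope to 4t minus the length of
      the next two jumps, which is at least 3t + 1.\<close>
    moreover have "F (F (?G q)) \<ge> ?G q + 3 * t + 1"
      using beyond[OF mem(2)] F(1,2)[OF mem(3)] by blast
    ultimately show ?thesis using jump[OF q] jump[OF mem(1)] by linarith
  qed
  obtain q where q: "q \<in> W" using \<open>W \<noteq> {}\<close> by blast
  have iter: "(?G ^^ k) q \<in> W \<and> F ((?G ^^ k) q) \<ge> F q + int k * (3 * t + 1)
    \<and> int (card (W \<inter> {F q<..F ((?G ^^ k) q)})) \<le> int k * (t - 1)" for k
  proof (induction k)
    case (Suc k)
    let ?p = "(?G ^^ k) q"
    have p: "?p \<in> W" and far: "F ?p \<ge> F q + int k * (3 * t + 1)" using Suc by auto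
    have mem: "F ?p \<in> W" "?G ?p \<in> W" "F (?G ?p) \<in> W" using F(1) p by blast+
    have step: "F (?G ?p) \<ge> F ?p + 3 * t + 1"
      using beyond[OF mem(1)] F(2)[OF mem(2)] mem(3) by blast
    have "int k * (3 * t + 1) \<ge> 0" using t by simp
    then have "F q \<le> F ?p" using far by linarith
    then have "{F q<..F (?G ?p)} = {F q<..F ?p} \<union> {F ?p<..F (?G ?p)}" using step t by auto
    then have "card (W \<inter> {F q<..F (?G ?p)}) \<le> card (W \<inter> {F q<..F ?p}) + card (W \<inter> {F ?p<..F (?G ?p)})"
      by (simp add: Int_Un_distrib card_Un_le)
    then have "int (card (W \<inter> {F q<..F (?G ?p)})) \<le> int k * (t - 1) + (t - 1)"
      using Suc double_jump[OF p] by linarith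
    then show ?case using mem(2) far step by (simp add: algebra_simps)
  qed (use q in simp)
  \<comment> \<open>Six double jumps advance at least 6(3t + 1) = 18t + 6, more than a full
    turn.\<close>
  define e where "e = F ((?G ^^ 6) q)"
  have "e \<ge> F q + 18 * t + 1" and *: "int (card (W \<inter> {F q<..e})) \<le> 6 * (t - 1)"
    using iter[of 6] unfolding e_def by auto
  then have "int (card (W \<inter> {F q<..F q + 18 * t + 1})) \<le> int (card (W \<inter> {F q<..e}))"
    by (intro of_nat_mono card_mono) auto
  also have "\<dots> \<le> 6 * t" using * by simp
  finally show ?thesis by blast
qed

lemma card_mixed_class_le:
  fixes t :: int
  assumes t: "t \<ge> 1" and n: "n = 18 * t + 1"
    and H: "diameter_two_subgraph H (circle_graph n ({3 * t + 1..5 * t} \<union> {8 * t + 1..9 * t}))"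
  shows "int (card (verts H)) \<le> 6 * t + 1"
proof (cases "verts H = {}")
  case False
  let ?S = "{3 * t + 1..5 * t} \<union> {8 * t + 1..9 * t}" and ?W = "unroll n (verts H)"
  have S: "?S \<subseteq> {1..n div 2}" and n0: "n > 0" using t n by auto
  note V = verts_in_range[OF S n0 H] and card = card_unroll_window[OF n0 verts_in_range[OF S n0 H]]
  have avoid: "x + d \<notin> ?W" if "x \<in> ?W" "2 * t \<le> d" "d \<le> 3 * t" for x d
  proof (rule unroll_avoids[OF S n0 H that(1)])
    show "0 < d" "d < n" "d \<notin> sym_dists n ?S"
      using t n that(2,3) by (auto simp: sym_dists_interval sym_dists_Un)
    \<comment> \<open>For these \<open>d\<close> the values \<open>n + d\<close> fill
      [20t+1, 21t+1], precisely the gap between the sums up to 20t and those from 21t + 2 on;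
      \<open>d\<close> itself is below the least sum 6t + 2.\<close>
    show "a + b \<noteq> d \<and> a + b \<noteq> n + d" if "a \<in> sym_dists n ?S" "b \<in> sym_dists n ?S" for a b
      using that t n \<open>2 * t \<le> d\<close> \<open>d \<le> 3 * t\<close> unfolding sym_dists_interval sym_dists_Un
      by (elim UnE) auto
  qed
  have ne: "?W \<noteq> {}" using nonempty_unroll[OF V False] by blast
  show ?thesis
  proof (cases "\<forall>v\<in>?W. \<exists>u\<in>?W. v < u \<and> u < v + 2 * t")
    case True
    then obtain v where "int (card (?W \<inter> {v<..v + 18 * t + 1})) \<le> 6 * t"
      using card_full_turn_no_gap_le[OF t avoid _ ne] by blast
    then show ?thesis using card[of v] n by (simp add: add.assoc)
  next
    case False
    then obtain v where v: "v \<in> ?W" and gap: "\<And>u. u \<in> ?W \<Longrightarrow> v < u \<Longrightarrow> u \<ge> v + 2 * t" by force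
    \<comment> \<open>The gap of length 2t and the forbidden differences clear everything from
      \<open>v + 1\<close> to \<open>v + 3 * t\<close>. Up to the copy \<open>v + n\<close> of
      \<open>v\<close>, exactly 15t integers remain.\<close>
    define p where "p = v + 3 * t + 1"
    let ?I = "\<lambda>i. {p + i * (5 * t)..<p + i * (5 * t) + 5 * t}"
    have "?W \<inter> {v<..v + n} \<subseteq> {v + n} \<union> ((?W \<inter> ?I 0) \<union> (?W \<inter> ?I 1) \<union> (?W \<inter> ?I 2))" (is "_ \<subseteq> ?U")
    proof
      fix u assume u: "u \<in> ?W \<inter> {v<..v + n}"
      then have "\<not> (2 * t \<le> u - v \<and> u - v \<le> 3 * t)" using avoid[OF v, of "u - v"] by force
      then have "u \<ge> p" using gap[of u] u unfolding p_def by auto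
      then show "u \<in> ?U" using u n unfolding p_def by auto
    qed
    then have "card (?W \<inter> {v<..v + n}) \<le> card ?U" by (intro card_mono) auto
    also have "\<dots> \<le> card {v + n} + card ((?W \<inter> ?I 0) \<union> (?W \<inter> ?I 1) \<union> (?W \<inter> ?I 2))"
      by (rule card_Un_le)
    also have "\<dots> \<le> card {v + n} + (card (?W \<inter> ?I 0) + card (?W \<inter> ?I 1) + card (?W \<inter> ?I 2))"
      by (intro add_left_mono card_Un3_le)
    finally have "int (card (verts H)) \<le> 1 + int (card (?W \<inter> ?I 0)) + int (card (?W \<inter> ?I 1)) + int (card (?W \<inter> ?I 2))"
      unfolding card by simp
    moreover have "int (card (?W \<inter> ?I i)) \<le> 2 * t" for i
      by (rule card_window_avoiding_le[OF t avoid])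
    note this[of 0] this[of 1] this[of 2]
    ultimately show ?thesis by linarith
  qed
qed (use t in auto)

section \<open>Tiling the distances by three classes and combining the bounds\<close>

theorem theorem2:
  fixes s n :: int
  assumes "s \<ge> 9" and "3 dvd s" and "n = 6 * s + 1"
  shows "\<exists>S :: nat \<Rightarrow> int set.
    (\<forall>i\<in>{1, 2, 3}. S i \<subseteq> {1..n div 2}) \<and>
    inj_on (\<lambda>i. edges (circle_graph n (S i))) {1, 2, 3} \<and>
    partition_on (edges (complete_graph {0..n - 1}))
      ((\<lambda>i. edges (circle_graph n (S i))) ` {1, 2, 3}) \<and>
    (\<forall>i\<in>{1, 2, 3}. \<forall>H. diameter_two_subgraph H (circle_graph n (S i)) \<longrightarrow>
      int (card (verts H)) \<le> 2 * s + 3)"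
proof -
  obtain t where s: "s = 3 * t" using assms(2) by blast
  have t: "t \<ge> 1" and n: "n = 18 * t + 1" using assms s by auto
  define S :: "nat \<Rightarrow> int set" where "S = (\<lambda>i. if i = 1 then {1..3 * t}
    else if i = 2 then {5 * t + 1..8 * t} else {3 * t + 1..5 * t} \<union> {8 * t + 1..9 * t})"
  have S: "S 1 = {1..3 * t}" "S 2 = {5 * t + 1..8 * t}"
    "S 3 = {3 * t + 1..5 * t} \<union> {8 * t + 1..9 * t}" by (simp_all add: S_def)
  have ne: "S i \<noteq> {}" if "i \<in> {1, 2, 3}" for i using that t S by auto
  \<comment> \<open>Here \<open>n div 2\<close> is 9t, and the four intervals tile {1..9t}.\<close>
  have un: "(\<Union>i\<in>{1, 2, 3}. S i) = {1..n div 2}" using t n S by auto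
  have disj: "disjoint_family_on S {1, 2, 3}"
    unfolding disjoint_family_on_def using S by auto
  \<comment> \<open>The bounds 6t + 1, 6t + 2 and 6t + 1 are all below 2s + 3 = 6t + 3.\<close>
  have "int (card (verts H)) \<le> 2 * s + 3"
    if "i \<in> {1, 2, 3}" "diameter_two_subgraph H (circle_graph n (S i))" for i H
    using that S s card_central_class_le[OF t n, of H] card_outer_class_le[OF t n, of H]
      card_mixed_class_le[OF t n, of H] by auto
  moreover have "\<forall>i\<in>{1, 2, 3}. S i \<subseteq> {1..n div 2}" using un by blast
  ultimately show ?thesis using circle_graphs_partition[OF ne un disj] by blast
qed

end
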